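(* Let $\mathcal{A}$ and $\mathcal{B}$ be locally finite ordered structures. Suppose that $\mathcal{A}$ is a semi-retraction of $\mathcal{B}$ and that $\mathcal{B}$ has the Ramsey property (RP). Then $\mathcal{A}$ has RP.
   Context: The structures $\mathcal{A}$ and $\mathcal{B}$ may have different signatures (sets of relation and function symbols). An ordered structure is a structure that is linearly ordered by some binary relation symbol in its signature. A structure is locally finite if all its finitely generated substructures are finite. Semi-retraction: for finite tuples $\bar\imath,\bar\jmath$ of the same length from a structure $\mathcal{A}$, write $\bar\imath\sim_{\mathcal{A}}\bar\jmath$ if they satisfy the same quantifier-free formulas in $\mathcal{A}$. Functions are applied to tuples coordinatewise. An injection $h:\mathcal{A}\to\mathcal{B}$ is quantifier-free type respecting (qftp-respecting) if for all finite same-length tuples $\bar\imath,\bar\jmath$ from $\mathcal{A}$, $\bar\imath\sim_{\mathcal{A}}\bar\jmath$ implies $h(\bar\imath)\sim_{\mathcal{B}}h(\bar\jmath)$. A complete quantifier-free type in $\mathcal{A}$ is the set of all quantifier-free formulas satisfied in $\mathcal{A}$ by some finite tuple from $\mathcal{A}$. $\mathcal{A}$ is a semi-retraction of $\mathcal{B}$ if there exist qftp-respecting injections $g:\mathcal{A}\to\mathcal{B}$ and $f:\mathcal{B}\to\mathcal{A}$ such that for every complete quantifier-free type $\eta$ in $\mathcal{A}$ and every $\bar s$ from $\mathcal{A}$, $\mathcal{A}\models\eta(\bar s)$ implies $\mathcal{A}\models\eta((f\circ g)(\bar s))$. Ramsey property: the age of a structure $\mathcal{I}$ is the class of all finitely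 generated substructures of $\mathcal{I}$, up to isomorphism. $\binom{\mathcal{D}}{\mathcal{C}}$ denotes the set of substructures of $\mathcal{D}$ isomorphic to $\mathcal{C}$. A class $\mathcal{K}$ of finite structures has RP if for all $\mathcal{C},\mathcal{D}\in\mathcal{K}$ and every integer $k\ge 2$ there is $\mathcal{E}\in\mathcal{K}$ such that for every function $c:\binom{\mathcal{E}}{\mathcal{C}}\to\{0,\dots,k-1\}$ there is $\mathcal{D}'\in\binom{\mathcal{E}}{\mathcal{D}}$ such that $c$ is constant on $\binom{\mathcal{D}'}{\mathcal{C}}$. A locally finite structure has RP if its age has RP. *)

theory Defs
  imports Main "HOL-Library.FuncSet"
begin

section \<open>Signatures and structures\<close>

text \<open>
  The symbols of a signature form sets rather than whole types, since HOL types are nonempty and a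
  signature may have no function symbols. Constants are function symbols of arity 0.
\<close>

record ('f, 'r) signature =
  funs :: "'f set"
  rels :: "'r set"
  fun_arity :: "'f \<Rightarrow> nat"
  rel_arity :: "'r \<Rightarrow> nat"

record ('f, 'r, 'a) struct =
  univ :: "'a set"
  fun_interp :: "'f \<Rightarrow> 'a list \<Rightarrow> 'a"
  rel_interp :: "'r \<Rightarrow> 'a list \<Rightarrow> bool"

definition tuples :: "('f, 'r, 'a) struct \<Rightarrow> nat \<Rightarrow> 'a list set" where
  "tuples A n = {xs. length xs = n \<and> set xs \<subseteq> univ A}"

definition closed_in :: "('f, 'r) signature \<Rightarrow> ('f, 'r, 'a) struct \<Rightarrow> 'a set \<Rightarrow> bool" where
  "closed_in L A X \<longleftrightarrow> X \<subseteq> univ A \<and>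
     (\<forall>F\<in>funs L. \<forall>xs. length xs = fun_arity L F \<and> set xs \<subseteq> X \<longrightarrow> fun_interp A F xs \<in> X)"

text \<open>
  Empty structures are allowed, so that the empty set generates a substructure also when there are
  no constants. For the Ramsey property this makes no difference: it is trivial whenever one of the
  two given structures is empty, and if neither is empty the third one cannot be empty.
\<close>

definition is_struct :: "('f, 'r) signature \<Rightarrow> ('f, 'r, 'a) struct \<Rightarrow> bool" where
  "is_struct L A \<longleftrightarrow> closed_in L A (univ A)"

definition ordered_struct :: "('f, 'r) signature \<Rightarrow> ('f, 'r, 'a) struct \<Rightarrow> bool" where
  "ordered_struct L A \<longleftrightarrow> is_struct L A \<and>
     (\<exists>R\<in>rels L. rel_arity L R = 2 \<and>
       (let r = {(x, y). x \<in> univ A \<and> y \<in> univ A \<and> rel_interp A R [x, y]}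
        in linear_order_on (univ A) r \<or> strict_linear_order_on (univ A) r))"

section \<open>Substructures, isomorphism and age\<close>

text \<open>
  A substructure keeps the ambient interpretation functions and shrinks only the universe. Hence a
  substructure is determined by its universe: the irrelevant values of the interpretations outside
  the universe do not produce several copies of one substructure.
\<close>

definition substructures ::
    "('f, 'r) signature \<Rightarrow> ('f, 'r, 'a) struct \<Rightarrow> ('f, 'r, 'a) struct set" where
  "substructures L A = {A\<lparr>univ := X\<rparr> | X. closed_in L A X}"

definition generated :: "('f, 'r) signature \<Rightarrow> ('f, 'r, 'a) struct \<Rightarrow> 'a set \<Rightarrow> ('f, 'r, 'a) struct" where
  "generated L A X = A\<lparr>univ := \<Inter>{Y. closed_in L A Y \<and> X \<subseteq> Y}\<rparr>"

definition fg_substructures ::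
    "('f, 'r) signature \<Rightarrow> ('f, 'r, 'a) struct \<Rightarrow> ('f, 'r, 'a) struct set" where
  "fg_substructures L A = {generated L A X | X. finite X \<and> X \<subseteq> univ A}"

definition locally_finite :: "('f, 'r) signature \<Rightarrow> ('f, 'r, 'a) struct \<Rightarrow> bool" where
  "locally_finite L A \<longleftrightarrow> (\<forall>S\<in>fg_substructures L A. finite (univ S))"

definition is_iso ::
    "('f, 'r) signature \<Rightarrow> ('f, 'r, 'a) struct \<Rightarrow> ('f, 'r, 'b) struct \<Rightarrow> ('a \<Rightarrow> 'b) \<Rightarrow> bool" where
  "is_iso L A B h \<longleftrightarrow> bij_betw h (univ A) (univ B) \<and>
     (\<forall>F\<in>funs L. \<forall>xs\<in>tuples A (fun_arity L F).
        h (fun_interp A F xs) = fun_interp B F (map h xs)) \<and>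
     (\<forall>R\<in>rels L. \<forall>xs\<in>tuples A (rel_arity L R).
        rel_interp A R xs \<longleftrightarrow> rel_interp B R (map h xs))"

definition isomorphic ::
    "('f, 'r) signature \<Rightarrow> ('f, 'r, 'a) struct \<Rightarrow> ('f, 'r, 'b) struct \<Rightarrow> bool" where
  "isomorphic L A B \<longleftrightarrow> (\<exists>h. is_iso L A B h)"

text \<open>
  The age is closed under isomorphism among the structures over the element type of \<open>A\<close>; every
  isomorphism class in the age has a representative over this type.
\<close>

definition age :: "('f, 'r) signature \<Rightarrow> ('f, 'r, 'a) struct \<Rightarrow> ('f, 'r, 'a) struct set" where
  "age L A = {C. is_struct L C \<and> (\<exists>S\<in>fg_substructures L A. isomorphic L C S)}"

section \<open>The Ramsey property\<close>

definition copies ::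
    "('f, 'r) signature \<Rightarrow> ('f, 'r, 'a) struct \<Rightarrow> ('f, 'r, 'a) struct \<Rightarrow> ('f, 'r, 'a) struct set" where
  "copies L D C = {S \<in> substructures L D. isomorphic L S C}"

definition class_RP :: "('f, 'r) signature \<Rightarrow> ('f, 'r, 'a) struct set \<Rightarrow> bool" where
  "class_RP L K \<longleftrightarrow>
     (\<forall>C\<in>K. \<forall>D\<in>K. \<forall>k::nat. k \<ge> 2 \<longrightarrow>
       (\<exists>E\<in>K. \<forall>c \<in> copies L E C \<rightarrow> {..<k}.
          \<exists>D'\<in>copies L E D. \<forall>S\<in>copies L D' C. \<forall>T\<in>copies L D' C. c S = c T))"

definition has_RP :: "('f, 'r) signature \<Rightarrow> ('f, 'r, 'a) struct \<Rightarrow> bool" where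
  "has_RP L A \<longleftrightarrow> class_RP L (age L A)"

section \<open>Quantifier-free formulas and types\<close>

datatype 'f fo_term = Var nat | App 'f "'f fo_term list"

datatype ('f, 'r) qf_formula =
    Bot
  | Eq "'f fo_term" "'f fo_term"
  | Rel 'r "'f fo_term list"
  | Neg "('f, 'r) qf_formula"
  | Conj "('f, 'r) qf_formula" "('f, 'r) qf_formula"
  | Disj "('f, 'r) qf_formula" "('f, 'r) qf_formula"

text \<open>The argument \<open>n\<close> restricts the variables to \<open>Var 0, \<dots>, Var (n - 1)\<close>.\<close>

fun wf_term :: "('f, 'r) signature \<Rightarrow> nat \<Rightarrow> 'f fo_term \<Rightarrow> bool" where
  "wf_term L n (Var i) \<longleftrightarrow> i < n"
| "wf_term L n (App F ts) \<longleftrightarrow>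
     F \<in> funs L \<and> length ts = fun_arity L F \<and> (\<forall>t\<in>set ts. wf_term L n t)"

fun wf_formula :: "('f, 'r) signature \<Rightarrow> nat \<Rightarrow> ('f, 'r) qf_formula \<Rightarrow> bool" where
  "wf_formula L n Bot \<longleftrightarrow> True"
| "wf_formula L n (Eq s t) \<longleftrightarrow> wf_term L n s \<and> wf_term L n t"
| "wf_formula L n (Rel R ts) \<longleftrightarrow>
     R \<in> rels L \<and> length ts = rel_arity L R \<and> (\<forall>t\<in>set ts. wf_term L n t)"
| "wf_formula L n (Neg p) \<longleftrightarrow> wf_formula L n p"
| "wf_formula L n (Conj p q) \<longleftrightarrow> wf_formula L n p \<and> wf_formula L n q"
| "wf_formula L n (Disj p q) \<longleftrightarrow> wf_formula L n p \<and> wf_formula L n q"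

fun eval_term :: "('f, 'r, 'a) struct \<Rightarrow> 'a list \<Rightarrow> 'f fo_term \<Rightarrow> 'a" where
  "eval_term A xs (Var i) = xs ! i"
| "eval_term A xs (App F ts) = fun_interp A F (map (eval_term A xs) ts)"

fun sat :: "('f, 'r, 'a) struct \<Rightarrow> 'a list \<Rightarrow> ('f, 'r) qf_formula \<Rightarrow> bool" where
  "sat A xs Bot \<longleftrightarrow> False"
| "sat A xs (Eq s t) \<longleftrightarrow> eval_term A xs s = eval_term A xs t"
| "sat A xs (Rel R ts) \<longleftrightarrow> rel_interp A R (map (eval_term A xs) ts)"
| "sat A xs (Neg p) \<longleftrightarrow> \<not> sat A xs p"
| "sat A xs (Conj p q) \<longleftrightarrow> sat A xs p \<and> sat A xs q"
| "sat A xs (Disj p q) \<longleftrightarrow> sat A xs p \<or> sat A xs q"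

definition qf_equiv ::
    "('f, 'r) signature \<Rightarrow> ('f, 'r, 'a) struct \<Rightarrow> 'a list \<Rightarrow> 'a list \<Rightarrow> bool" where
  "qf_equiv L A xs ys \<longleftrightarrow> length xs = length ys \<and>
     (\<forall>p. wf_formula L (length xs) p \<longrightarrow> sat A xs p = sat A ys p)"

definition complete_qf_types ::
    "('f, 'r) signature \<Rightarrow> ('f, 'r, 'a) struct \<Rightarrow> nat \<Rightarrow> ('f, 'r) qf_formula set set" where
  "complete_qf_types L A n = {{p. wf_formula L n p \<and> sat A xs p} | xs. xs \<in> tuples A n}"

definition realizes :: "('f, 'r, 'a) struct \<Rightarrow> 'a list \<Rightarrow> ('f, 'r) qf_formula set \<Rightarrow> bool" where
  "realizes A xs \<eta> \<longleftrightarrow> (\<forall>p\<in>\<eta>. sat A xs p)"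

section \<open>Semi-retractions\<close>

definition qftp_respecting_injection ::
    "('f, 'r) signature \<Rightarrow> ('f, 'r, 'a) struct \<Rightarrow> ('g, 's) signature \<Rightarrow> ('g, 's, 'b) struct
      \<Rightarrow> ('a \<Rightarrow> 'b) \<Rightarrow> bool" where
  "qftp_respecting_injection L A M B h \<longleftrightarrow>
     h \<in> univ A \<rightarrow> univ B \<and> inj_on h (univ A) \<and>
     (\<forall>n. \<forall>xs\<in>tuples A n. \<forall>ys\<in>tuples A n.
        qf_equiv L A xs ys \<longrightarrow> qf_equiv M B (map h xs) (map h ys))"

definition semi_retraction ::
    "('f, 'r) signature \<Rightarrow> ('f, 'r, 'a) struct \<Rightarrow> ('g, 's) signature \<Rightarrow> ('g, 's, 'b) struct \<Rightarrow> bool"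
  where
  "semi_retraction L A M B \<longleftrightarrow>
     (\<exists>g f. qftp_respecting_injection L A M B g \<and> qftp_respecting_injection M B L A f \<and>
        (\<forall>n. \<forall>\<eta>\<in>complete_qf_types L A n. \<forall>xs\<in>tuples A n.
           realizes A xs \<eta> \<longrightarrow> realizes A (map (f \<circ> g) xs) \<eta>))"

end

theory Submission
  imports Defs
begin

text \<open>
  Write \<open>xs \<sim> ys\<close> when two tuples, possibly from different structures of one signature, satisfy the
  same quantifier-free formulas. By lemmas \<open>iso_same_qf_type\<close> and \<open>same_qf_type_imp_iso\<close> this
  holds exactly when \<open>xs \<mapsto> ys\<close> extends to an isomorphism of the generated substructures. Copies of
  finite structures can therefore be traded for tuples of a given type, and such tuples are what the
  maps \<open>g\<close> and \<open>f\<close> of a semi-retraction transport.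

  Let \<open>cs\<close> and \<open>ds\<close> enumerate finite substructures \<open>C\<close> and \<open>D\<close> of \<open>A\<close>, let \<open>C\<^sub>B\<close> and \<open>D\<^sub>B\<close> be the
  substructures of \<open>B\<close> generated by \<open>g(cs)\<close> and \<open>g(ds)\<close>, and choose \<open>E\<^sub>B\<close> in the age of \<open>B\<close>
  for \<open>C\<^sub>B\<close>, \<open>D\<^sub>B\<close> and \<open>k\<close> colours. Embed \<open>E\<^sub>B\<close> into \<open>B\<close> by \<open>e\<close>, and let \<open>E\<close> be generated by
  \<open>f(e(E\<^sub>B))\<close>. A tuple \<open>ys\<close> in \<open>E\<^sub>B\<close> with \<open>ys \<sim> g(cs)\<close> satisfies
  \<open>f(e(ys)) \<sim> f(g(cs)) \<sim> cs\<close>, so \<open>f(e(ys))\<close> enumerates a copy of \<open>C\<close> in \<open>E\<close>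
  (lemma \<open>pull_back_type\<close>); the same holds for \<open>ds\<close>.

  A colouring \<open>c\<close> of the copies of \<open>C\<close> in \<open>E\<close> thus induces a colouring of the copies \<open>T\<close> of \<open>C\<^sub>B\<close> in
  \<open>E\<^sub>B\<close>: if \<open>\<sigma>\<close> is the isomorphism from \<open>C\<^sub>B\<close> to \<open>T\<close>, then \<open>T\<close> gets the colour of
  \<open>f(e(\<sigma>(g(cs))))\<close>. The linear order of \<open>B\<close> enters here: it makes \<open>C\<^sub>B\<close> rigid, so \<open>\<sigma>\<close> is determined
  by \<open>T\<close> (lemma \<open>iso_unique\<close>). Let \<open>\<tau>\<close> be an isomorphism from \<open>D\<^sub>B\<close> to a homogeneous copy, and let
  \<open>\<theta> = f \<circ> e \<circ> \<tau> \<circ> g\<close>. Then \<open>\<theta>\<close> maps \<open>D\<close> isomorphically to a copy \<open>D'\<close> in \<open>E\<close>. Every copy of \<open>C\<close>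
  in \<open>D'\<close> is \<open>\<theta>(zs)\<close> with \<open>zs\<close> from \<open>D\<close> and \<open>zs \<sim> cs\<close>; hence \<open>g(zs) \<sim> g(cs)\<close>, and the colour of
  \<open>\<theta>(zs)\<close> is the induced colour of the copy of \<open>C\<^sub>B\<close> generated by \<open>\<tau>(g(zs))\<close>. So \<open>D'\<close> is
  homogeneous for \<open>c\<close>.
\<close>

section \<open>Substructures and isomorphisms\<close>

lemma is_struct_funD:
  assumes "is_struct L X" "F \<in> funs L" "length xs = fun_arity L F" "set xs \<subseteq> univ X"
  shows "fun_interp X F xs \<in> univ X"
  using assms unfolding is_struct_def closed_in_def by blast

lemma is_struct_restrict:
  assumes "closed_in L X U"
  shows "is_struct L (X\<lparr>univ := U\<rparr>)"
  using assms unfolding is_struct_def closed_in_def by simp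

lemma substructures_iff:
  "S \<in> substructures L X \<longleftrightarrow> S = X\<lparr>univ := univ S\<rparr> \<and> closed_in L X (univ S)"
  unfolding substructures_def by auto

lemma substructures_is_struct:
  assumes "S \<in> substructures L X"
  shows "is_struct L S"
  using assms is_struct_restrict unfolding substructures_def by auto

lemma substructures_subset:
  assumes "S \<in> substructures L X"
  shows "univ S \<subseteq> univ X"
  using assms unfolding substructures_def closed_in_def by auto

lemma substructures_trans:
  assumes "S \<in> substructures L Y" "Y \<in> substructures L X"
  shows "S \<in> substructures L X"
proof -
  obtain U V where "Y = X\<lparr>univ := V\<rparr>" "S = Y\<lparr>univ := U\<rparr>" "closed_in L X V" "closed_in L Y U"
    using assms unfolding substructures_def by blast
  then have "S = X\<lparr>univ := U\<rparr>" "closed_in L X U" unfolding closed_in_def by auto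
  then show ?thesis unfolding substructures_def by blast
qed

lemma closed_in_generated:
  assumes "is_struct L X" "Z \<subseteq> univ X"
  shows "closed_in L X (univ (generated L X Z))"
proof -
  let ?Y = "\<Inter>{Y. closed_in L X Y \<and> Z \<subseteq> Y}"
  have "univ X \<in> {Y. closed_in L X Y \<and> Z \<subseteq> Y}"
    using assms by (simp add: is_struct_def)
  then have "?Y \<subseteq> univ X" by blast
  moreover have "fun_interp X F xs \<in> ?Y"
    if "F \<in> funs L" "length xs = fun_arity L F" "set xs \<subseteq> ?Y" for F xs
    using that unfolding closed_in_def by blast
  ultimately show ?thesis
    unfolding generated_def closed_in_def by simp
qed

lemma generated_substructure:
  assumes "is_struct L X" "Z \<subseteq> univ X"
  shows "generated L X Z \<in> substructures L X"
  using closed_in_generated[OF assms] unfolding substructures_iff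
  by (simp add: generated_def)

lemma generated_superset: "Z \<subseteq> univ (generated L X Z)"
  unfolding generated_def by auto

lemma generated_closed:
  assumes "closed_in L X Z"
  shows "generated L X Z = X\<lparr>univ := Z\<rparr>"
proof -
  have "\<Inter>{Y. closed_in L X Y \<and> Z \<subseteq> Y} = Z" using assms by auto
  then show ?thesis unfolding generated_def by simp
qed

lemma fg_substructures_substructure:
  assumes "is_struct L X" "S \<in> fg_substructures L X"
  shows "S \<in> substructures L X"
  using assms generated_substructure unfolding fg_substructures_def by auto

lemma is_iso_id: "is_iso L X X id"
  unfolding is_iso_def by simp

lemma is_iso_mem:
  assumes "is_iso L X Y h" "a \<in> univ X"
  shows "h a \<in> univ Y"
  using assms unfolding is_iso_def bij_betw_def by auto

lemma is_iso_comp: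
  assumes h: "is_iso L X Y h" and h': "is_iso L Y Z h'"
  shows "is_iso L X Z (h' \<circ> h)"
proof -
  have t: "map h xs \<in> tuples Y n" if "xs \<in> tuples X n" for xs n
    using that is_iso_mem[OF h] unfolding tuples_def by auto
  have "bij_betw (h' \<circ> h) (univ X) (univ Z)"
    using h h' bij_betw_trans unfolding is_iso_def by blast
  moreover have "(h' \<circ> h) (fun_interp X F xs) = fun_interp Z F (map (h' \<circ> h) xs)"
    if "F \<in> funs L" "xs \<in> tuples X (fun_arity L F)" for F xs
    using h h' that t[OF that(2)] unfolding is_iso_def by simp
  moreover have "rel_interp X R xs \<longleftrightarrow> rel_interp Z R (map (h' \<circ> h) xs)"
    if "R \<in> rels L" "xs \<in> tuples X (rel_arity L R)" for R xs
    using h h' that t[OF that(2)] unfolding is_iso_def by simp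
  ultimately show ?thesis unfolding is_iso_def by blast
qed

lemma is_iso_inv:
  assumes h: "is_iso L X Y h" and X: "is_struct L X"
  shows "is_iso L Y X (the_inv_into (univ X) h)"
proof -
  let ?k = "the_inv_into (univ X) h"
  have bij: "bij_betw h (univ X) (univ Y)" using h unfolding is_iso_def by simp
  have inj: "inj_on h (univ X)" using bij by (simp add: bij_betw_def)
  have k_bij: "bij_betw ?k (univ Y) (univ X)" using bij bij_betw_the_inv_into by blast
  have hk: "h (?k b) = b" if "b \<in> univ Y" for b
    using bij that f_the_inv_into_f_bij_betw by fastforce
  have t: "map ?k ys \<in> tuples X n" if "ys \<in> tuples Y n" for ys n
    using that k_bij unfolding tuples_def bij_betw_def by auto
  have hks: "map h (map ?k ys) = ys" if "ys \<in> tuples Y n" for ys n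
    using that hk unfolding tuples_def by (auto intro!: map_idI)
  have "?k (fun_interp Y F ys) = fun_interp X F (map ?k ys)"
    if "F \<in> funs L" "ys \<in> tuples Y (fun_arity L F)" for F ys
  proof -
    have "h (fun_interp X F (map ?k ys)) = fun_interp Y F (map h (map ?k ys))"
      using h that(1) t[OF that(2)] unfolding is_iso_def by blast
    moreover have "fun_interp X F (map ?k ys) \<in> univ X"
      using is_struct_funD[OF X that(1)] t[OF that(2)] unfolding tuples_def by auto
    ultimately show ?thesis
      using hks[OF that(2)] the_inv_into_f_f[OF inj] by metis
  qed
  moreover have "rel_interp Y R ys \<longleftrightarrow> rel_interp X R (map ?k ys)"
    if "R \<in> rels L" "ys \<in> tuples Y (rel_arity L R)" for R ys
    using h that(1) t[OF that(2)] hks[OF that(2)] unfolding is_iso_def by metis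
  ultimately show ?thesis using k_bij unfolding is_iso_def by blast
qed

lemma is_iso_cong:
  assumes X: "is_struct L X" and eq: "\<And>a. a \<in> univ X \<Longrightarrow> h a = h' a"
    and h: "is_iso L X Y h"
  shows "is_iso L X Y h'"
proof -
  have m: "map h' xs = map h xs" if "xs \<in> tuples X n" for xs n
    using that eq unfolding tuples_def by auto
  have "bij_betw h' (univ X) (univ Y)"
    using h eq bij_betw_cong unfolding is_iso_def by metis
  moreover have "h' (fun_interp X F xs) = fun_interp Y F (map h' xs)"
    if "F \<in> funs L" "xs \<in> tuples X (fun_arity L F)" for F xs
  proof -
    have "fun_interp X F xs \<in> univ X"
      using is_struct_funD[OF X that(1)] that(2) unfolding tuples_def by auto
    then show ?thesis using h that m[OF that(2)] eq unfolding is_iso_def by metis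
  qed
  moreover have "rel_interp X R xs \<longleftrightarrow> rel_interp Y R (map h' xs)"
    if "R \<in> rels L" "xs \<in> tuples X (rel_arity L R)" for R xs
    using h that m[OF that(2)] unfolding is_iso_def by metis
  ultimately show ?thesis unfolding is_iso_def by blast
qed

lemma isomorphic_sym:
  assumes "is_struct L X" "isomorphic L X Y"
  shows "isomorphic L Y X"
  using assms is_iso_inv unfolding isomorphic_def by blast

lemma isomorphic_trans:
  assumes "isomorphic L X Y" "isomorphic L Y Z"
  shows "isomorphic L X Z"
  using assms is_iso_comp unfolding isomorphic_def by blast

lemma copies_cong:
  assumes "is_struct L C" "isomorphic L C C'"
  shows "copies L X C = copies L X C'"
  using assms isomorphic_trans isomorphic_sym unfolding copies_def by blast

lemma fg_substructure_in_age:
  assumes "is_struct L X" "S \<in> fg_substructures L X"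
  shows "S \<in> age L X"
proof -
  have "is_struct L S"
    using fg_substructures_substructure[OF assms] substructures_is_struct by blast
  moreover have "isomorphic L S S" using is_iso_id unfolding isomorphic_def by blast
  ultimately show ?thesis using assms(2) unfolding age_def by blast
qed

section \<open>Quantifier-free types across structures\<close>

text \<open>
  The relation \<open>qf_equiv\<close> compares tuples of one structure. The Ramsey argument also compares
  tuples of \<open>B\<close> with tuples of a member of its age, which need not be a substructure of \<open>B\<close>.
\<close>

definition same_qf_type ::
    "('f, 'r) signature \<Rightarrow> ('f, 'r, 'a) struct \<Rightarrow> 'a list \<Rightarrow> ('f, 'r, 'b) struct \<Rightarrow> 'b list \<Rightarrow> bool"
  where
  "same_qf_type L X xs Y ys \<longleftrightarrow> length xs = length ys \<and>
     (\<forall>p. wf_formula L (length xs) p \<longrightarrow> sat X xs p = sat Y ys p)"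

lemma qf_equiv_same_qf_type: "qf_equiv L X xs ys \<longleftrightarrow> same_qf_type L X xs X ys"
  unfolding qf_equiv_def same_qf_type_def by simp

lemma same_qf_type_sym: "same_qf_type L X xs Y ys \<Longrightarrow> same_qf_type L Y ys X xs"
  unfolding same_qf_type_def by simp

lemma same_qf_type_trans:
  "same_qf_type L X xs Y ys \<Longrightarrow> same_qf_type L Y ys Z zs \<Longrightarrow> same_qf_type L X xs Z zs"
  unfolding same_qf_type_def by simp

lemma eval_term_restrict: "eval_term (X\<lparr>univ := U\<rparr>) xs t = eval_term X xs t"
proof (induction t)
  case (App F ts)
  then have "map (eval_term (X\<lparr>univ := U\<rparr>) xs) ts = map (eval_term X xs) ts" by simp
  then show ?case by (simp del: map_eq_conv)
qed simp

lemma sat_restrict: "sat (X\<lparr>univ := U\<rparr>) xs p = sat X xs p"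
proof (induction p)
  case (Rel R ts)
  have "map (eval_term (X\<lparr>univ := U\<rparr>) xs) ts = map (eval_term X xs) ts"
    by (simp add: eval_term_restrict)
  then show ?case by (simp del: map_eq_conv)
qed (simp_all add: eval_term_restrict)

lemma sat_substructure:
  assumes "S \<in> substructures L X"
  shows "sat S xs p = sat X xs p"
  using assms sat_restrict unfolding substructures_def by auto

lemma same_qf_type_substructure:
  assumes "S \<in> substructures L X"
  shows "same_qf_type L S xs Y ys \<longleftrightarrow> same_qf_type L X xs Y ys"
    and "same_qf_type L Y ys S xs \<longleftrightarrow> same_qf_type L Y ys X xs"
  using sat_substructure[OF assms] unfolding same_qf_type_def by simp_all

lemma eval_term_mem:
  assumes X: "is_struct L X" and xs: "set xs \<subseteq> univ X"
  shows "wf_term L (length xs) t \<Longrightarrow> eval_term X xs t \<in> univ X"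
proof (induction t)
  case (Var i)
  then show ?case using xs by auto
next
  case (App F ts)
  have "set (map (eval_term X xs) ts) \<subseteq> univ X" using App by auto
  then show ?case using is_struct_funD[OF X, of F "map (eval_term X xs) ts"] App.prems by simp
qed

lemma eval_term_iso:
  assumes h: "is_iso L X Y h" and X: "is_struct L X" and xs: "set xs \<subseteq> univ X"
  shows "wf_term L (length xs) t \<Longrightarrow> eval_term Y (map h xs) t = h (eval_term X xs t)"
proof (induction t)
  case (App F ts)
  let ?as = "map (eval_term X xs) ts"
  have as: "?as \<in> tuples X (fun_arity L F)"
    using App.prems eval_term_mem[OF X xs] unfolding tuples_def by auto
  have "map (eval_term Y (map h xs)) ts = map h ?as" using App by simp
  then have "eval_term Y (map h xs) (App F ts) = fun_interp Y F (map h ?as)"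
    by (simp del: map_map map_eq_conv)
  also have "\<dots> = h (fun_interp X F ?as)"
    using h as App.prems unfolding is_iso_def by (simp del: map_map)
  finally show ?case by simp
qed simp

lemma iso_same_qf_type:
  assumes h: "is_iso L X Y h" and X: "is_struct L X" and xs: "set xs \<subseteq> univ X"
  shows "same_qf_type L X xs Y (map h xs)"
proof -
  have inj: "inj_on h (univ X)" using h unfolding is_iso_def bij_betw_def by simp
  have "sat X xs p = sat Y (map h xs) p" if "wf_formula L (length xs) p" for p
    using that
  proof (induction p)
    case (Eq s t)
    then show ?case
      using eval_term_iso[OF h X xs] eval_term_mem[OF X xs] inj_on_eq_iff[OF inj] by simp
  next
    case (Rel R ts)
    let ?as = "map (eval_term X xs) ts"
    have as: "?as \<in> tuples X (rel_arity L R)"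
      using Rel.prems eval_term_mem[OF X xs] unfolding tuples_def by auto
    have m: "map (eval_term Y (map h xs)) ts = map h ?as"
      using Rel.prems eval_term_iso[OF h X xs] by simp
    have "sat Y (map h xs) (Rel R ts) = rel_interp Y R (map h ?as)"
      using m by (simp del: map_map map_eq_conv)
    also have "\<dots> = rel_interp X R ?as"
      using h as Rel.prems unfolding is_iso_def by (simp del: map_map)
    finally show ?case by simp
  qed simp_all
  then show ?thesis unfolding same_qf_type_def by simp
qed

lemma univ_generated:
  assumes X: "is_struct L X" and xs: "set xs \<subseteq> univ X"
  shows "univ (generated L X (set xs)) = eval_term X xs ` {t. wf_term L (length xs) t}"
    (is "?G = ?T")
proof
  have "set xs \<subseteq> ?T"
  proof
    fix a assume "a \<in> set xs"
    then obtain i where "i < length xs" "a = xs ! i" by (metis in_set_conv_nth)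
    then show "a \<in> ?T" by (intro image_eqI[where x = "Var i"]) auto
  qed
  moreover have "closed_in L X ?T"
    unfolding closed_in_def
  proof (intro conjI ballI allI impI)
    show "?T \<subseteq> univ X" using eval_term_mem[OF X xs] by auto
  next
    fix F as assume F: "F \<in> funs L" and as: "length as = fun_arity L F \<and> set as \<subseteq> ?T"
    have "as \<in> lists ?T" using as by auto
    then obtain ts where ts: "as = map (eval_term X xs) ts" "\<forall>t\<in>set ts. wf_term L (length xs) t"
      unfolding lists_image by auto
    show "fun_interp X F as \<in> ?T"
      by (rule image_eqI[where x = "App F ts"]) (use ts as F in auto)
  qed
  ultimately show "?G \<subseteq> ?T" unfolding generated_def by auto
next
  let ?S = "generated L X (set xs)"
  have S: "?S \<in> substructures L X" by (rule generated_substructure[OF X xs])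
  have "eval_term ?S xs t \<in> ?G" if "wf_term L (length xs) t" for t
    using eval_term_mem[OF substructures_is_struct[OF S] generated_superset that] .
  then show "?T \<subseteq> ?G" by (auto simp: generated_def eval_term_restrict)
qed

text \<open>
  An element of the generated substructure is the value of some term. Equality formulas make the
  assignment of the value at \<open>xs\<close> to the value at \<open>ys\<close> of the same term well defined and injective.
\<close>

lemma same_qf_type_imp_iso:
  assumes X: "is_struct L X" and xs: "set xs \<subseteq> univ X"
    and Y: "is_struct L Y" and ys: "set ys \<subseteq> univ Y"
    and eqv: "same_qf_type L X xs Y ys"
  obtains h where "is_iso L (generated L X (set xs)) (generated L Y (set ys)) h" "map h xs = ys"
proof -
  let ?n = "length xs"
  let ?W = "{t. wf_term L ?n t}"
  let ?GX = "generated L X (set xs)" and ?GY = "generated L Y (set ys)"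
  have len: "length ys = ?n" using eqv unfolding same_qf_type_def by simp
  have sat: "sat X xs p = sat Y ys p" if "wf_formula L ?n p" for p
    using eqv that unfolding same_qf_type_def by simp
  have uX: "univ ?GX = eval_term X xs ` ?W" using univ_generated[OF X xs] .
  have uY: "univ ?GY = eval_term Y ys ` ?W" using univ_generated[OF Y ys] len by simp
  have eq: "eval_term X xs s = eval_term X xs t \<longleftrightarrow> eval_term Y ys s = eval_term Y ys t"
    if "wf_term L ?n s" "wf_term L ?n t" for s t
    using sat[of "Eq s t"] that by simp
  define h where "h a = eval_term Y ys (SOME t. wf_term L ?n t \<and> eval_term X xs t = a)" for a
  have h: "h (eval_term X xs t) = eval_term Y ys t" if "wf_term L ?n t" for t
  proof -
    define s where "s = (SOME s. wf_term L ?n s \<and> eval_term X xs s = eval_term X xs t)"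
    have "wf_term L ?n s \<and> eval_term X xs s = eval_term X xs t"
      unfolding s_def by (rule someI[where x = t]) (use that in simp)
    then show ?thesis using eq[of s t] that unfolding h_def s_def by simp
  qed
  have lift: "\<exists>ts. as = map (eval_term X xs) ts \<and> length ts = m \<and> (\<forall>t\<in>set ts. wf_term L ?n t)"
    if "as \<in> tuples ?GX m" for as m
  proof -
    have "as \<in> lists (eval_term X xs ` ?W)" "length as = m"
      using that uX unfolding tuples_def by auto
    then show ?thesis unfolding lists_image by auto
  qed
  have "bij_betw h (univ ?GX) (univ ?GY)"
    unfolding bij_betw_def
  proof
    show "inj_on h (univ ?GX)" unfolding uX by (auto intro!: inj_onI simp: h eq)
    show "h ` univ ?GX = univ ?GY" unfolding uX uY image_image by (simp add: h)
  qed
  moreover have "h (fun_interp ?GX F as) = fun_interp ?GY F (map h as)"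
    if F: "F \<in> funs L" and as: "as \<in> tuples ?GX (fun_arity L F)" for F as
  proof -
    obtain ts where ts: "as = map (eval_term X xs) ts" "length ts = fun_arity L F"
        "\<forall>t\<in>set ts. wf_term L ?n t"
      using lift[OF as] by blast
    have "map h as = map (eval_term Y ys) ts" using ts h by simp
    then show ?thesis
      using h[of "App F ts"] ts F by (simp add: generated_def del: map_map)
  qed
  moreover have "rel_interp ?GX R as \<longleftrightarrow> rel_interp ?GY R (map h as)"
    if R: "R \<in> rels L" and as: "as \<in> tuples ?GX (rel_arity L R)" for R as
  proof -
    obtain ts where ts: "as = map (eval_term X xs) ts" "length ts = rel_arity L R"
        "\<forall>t\<in>set ts. wf_term L ?n t"
      using lift[OF as] by blast
    have "map h as = map (eval_term Y ys) ts" using ts h by simp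
    then show ?thesis
      using sat[of "Rel R ts"] ts R by (simp add: generated_def del: map_map)
  qed
  ultimately have "is_iso L ?GX ?GY h" unfolding is_iso_def by blast
  moreover have "map h xs = ys"
    using h[of "Var _"] len by (auto intro!: nth_equalityI)
  ultimately show thesis using that by blast
qed

text \<open>When the tuple \<open>xs\<close> enumerates a whole substructure, so does every tuple of its type.\<close>

lemma same_qf_type_closed:
  assumes X: "is_struct L X" and Y: "is_struct L Y" and xs: "closed_in L X (set xs)"
    and ys: "set (map \<phi> xs) \<subseteq> univ Y" and eqv: "same_qf_type L X xs Y (map \<phi> xs)"
  shows "Y\<lparr>univ := \<phi> ` set xs\<rparr> \<in> substructures L Y"
    and "is_iso L (X\<lparr>univ := set xs\<rparr>) (Y\<lparr>univ := \<phi> ` set xs\<rparr>) \<phi>"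
proof -
  have sub: "set xs \<subseteq> univ X" using xs unfolding closed_in_def by simp
  let ?X = "X\<lparr>univ := set xs\<rparr>" and ?Y = "generated L Y (set (map \<phi> xs))"
  obtain h where h: "is_iso L (generated L X (set xs)) ?Y h" "map h xs = map \<phi> xs"
    using same_qf_type_imp_iso[OF X sub Y ys eqv] by blast
  then have h1: "is_iso L ?X ?Y h" using generated_closed[OF xs] by simp
  have phi: "is_iso L ?X ?Y \<phi>"
    by (rule is_iso_cong[OF is_struct_restrict[OF xs] _ h1]) (use h(2) in auto)
  then have "univ ?Y = \<phi> ` set xs" unfolding is_iso_def bij_betw_def by simp
  then have Y_eq: "?Y = Y\<lparr>univ := \<phi> ` set xs\<rparr>"
    unfolding generated_def by simp
  show "Y\<lparr>univ := \<phi> ` set xs\<rparr> \<in> substructures L Y"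
    using generated_substructure[OF Y ys] Y_eq by simp
  show "is_iso L ?X (Y\<lparr>univ := \<phi> ` set xs\<rparr>) \<phi>" using phi Y_eq by simp
qed

section \<open>Rigidity of finite ordered structures\<close>

text \<open>In a finite linear order, an element is determined by its number of predecessors.\<close>

lemma finite_linear_automorphism_id:
  assumes fin: "finite S" and bij: "bij_betw h S S"
    and mono: "\<And>x y. x \<in> S \<Longrightarrow> y \<in> S \<Longrightarrow> P x y \<longleftrightarrow> P (h x) (h y)"
    and trans: "\<And>x y z. x \<in> S \<Longrightarrow> y \<in> S \<Longrightarrow> z \<in> S \<Longrightarrow> P x y \<Longrightarrow> P y z \<Longrightarrow> P x z"
    and irrefl: "\<And>x. x \<in> S \<Longrightarrow> \<not> P x x"
    and total: "\<And>x y. x \<in> S \<Longrightarrow> y \<in> S \<Longrightarrow> x \<noteq> y \<Longrightarrow> P x y \<or> P y x"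
    and x: "x \<in> S"
  shows "h x = x"
proof -
  define pre where "pre x = {y \<in> S. P y x}" for x
  have hS: "h ` S = S" and inj: "inj_on h S" using bij unfolding bij_betw_def by auto
  have less: "card (pre y) < card (pre z)" if "y \<in> S" "z \<in> S" "P y z" for y z
  proof (rule psubset_card_mono)
    show "finite (pre z)" using fin unfolding pre_def by simp
    have "pre y \<subseteq> pre z" using trans that unfolding pre_def by blast
    moreover have "y \<in> pre z" "y \<notin> pre y" using that irrefl unfolding pre_def by auto
    ultimately show "pre y \<subset> pre z" by blast
  qed
  have "pre (h x) = h ` pre x"
  proof
    show "pre (h x) \<subseteq> h ` pre x"
    proof
      fix y assume y: "y \<in> pre (h x)"
      then obtain z where "z \<in> S" "y = h z" using hS unfolding pre_def by blast
      then show "y \<in> h ` pre x" using y mono x unfolding pre_def by blast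
    qed
    show "h ` pre x \<subseteq> pre (h x)" using mono x hS unfolding pre_def by blast
  qed
  moreover have "inj_on h (pre x)" using inj unfolding pre_def by (rule inj_on_subset) auto
  ultimately have card: "card (pre (h x)) = card (pre x)" by (simp add: card_image)
  have hx: "h x \<in> S" using x hS by blast
  show ?thesis
  proof (rule ccontr)
    assume "h x \<noteq> x"
    then show False using total[OF x hx] less[OF x hx] less[OF hx x] card by auto
  qed
qed

lemma ordered_struct_rigid:
  assumes ord: "ordered_struct L X" and S: "S \<in> substructures L X" and fin: "finite (univ S)"
    and h: "is_iso L S S h" and x: "x \<in> univ S"
  shows "h x = x"
proof -
  obtain R where R: "R \<in> rels L" "rel_arity L R = 2" and
    lin: "let r = {(x, y). x \<in> univ X \<and> y \<in> univ X \<and> rel_interp X R [x, y]}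
          in linear_order_on (univ X) r \<or> strict_linear_order_on (univ X) r"
    using ord unfolding ordered_struct_def by blast
  \<comment> \<open>Removing the diagonal treats reflexive and strict orders alike.\<close>
  define P where "P x y \<longleftrightarrow> x \<noteq> y \<and> rel_interp X R [x, y]" for x y
  have sub: "univ S \<subseteq> univ X" using substructures_subset[OF S] .
  have bij: "bij_betw h (univ S) (univ S)" using h unfolding is_iso_def by simp
  have rel: "rel_interp S R = rel_interp X R" using S unfolding substructures_def by auto
  have total: "P x y \<or> P y x" if "x \<in> univ X" "y \<in> univ X" "x \<noteq> y" for x y
    using lin that unfolding Let_def P_def linear_order_on_def strict_linear_order_on_def total_on_def
    by auto
  have trans: "P x z" if "x \<in> univ X" "y \<in> univ X" "z \<in> univ X" "P x y" "P y z" for x y z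
  proof -
    let ?r = "{(x, y). x \<in> univ X \<and> y \<in> univ X \<and> rel_interp X R [x, y]}"
    have "trans ?r" and "antisym ?r \<or> irrefl ?r"
      using lin unfolding Let_def linear_order_on_def strict_linear_order_on_def partial_order_on_def
        preorder_on_def by auto
    moreover have xy: "(x, y) \<in> ?r" and yz: "(y, z) \<in> ?r" and "x \<noteq> y"
      using that unfolding P_def by auto
    moreover have "(x, z) \<in> ?r" using \<open>trans ?r\<close> xy yz by (rule transD)
    ultimately have "(x, z) \<in> ?r" "x \<noteq> z"
      by (auto dest: antisymD irreflD)
    then show ?thesis unfolding P_def by simp
  qed
  have mono: "P x y \<longleftrightarrow> P (h x) (h y)" if "x \<in> univ S" "y \<in> univ S" for x y
  proof -
    have "[x, y] \<in> tuples S (rel_arity L R)" using R that unfolding tuples_def by simp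
    then have "rel_interp S R [x, y] \<longleftrightarrow> rel_interp S R (map h [x, y])"
      using h R unfolding is_iso_def by blast
    moreover have "h x = h y \<longleftrightarrow> x = y"
      using bij that unfolding bij_betw_def by (meson inj_on_eq_iff)
    ultimately show ?thesis unfolding P_def rel by simp
  qed
  show ?thesis
  proof (rule finite_linear_automorphism_id[where P = P, OF fin bij mono _ _ _ x])
    show "P a c" if "a \<in> univ S" "b \<in> univ S" "c \<in> univ S" "P a b" "P b c" for a b c
      using trans that sub by blast
    show "\<not> P a a" for a unfolding P_def by simp
    show "P a b \<or> P b a" if "a \<in> univ S" "b \<in> univ S" "a \<noteq> b" for a b
      using total that sub by blast
  qed
qed

lemma iso_unique:
  assumes "ordered_struct L X" "S \<in> substructures L X" "finite (univ S)"
    and h: "is_iso L S T h" and h': "is_iso L S T h'" and x: "x \<in> univ S"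
  shows "h x = h' x"
proof -
  let ?k = "the_inv_into (univ S) h'"
  have automorphism: "is_iso L S S (?k \<circ> h)"
    using is_iso_comp[OF h is_iso_inv[OF h' substructures_is_struct[OF assms(2)]]] .
  have "?k (h x) = x" using ordered_struct_rigid[OF assms(1-3) automorphism x] by simp
  moreover have "bij_betw h' (univ S) (univ T)" using h' unfolding is_iso_def by simp
  ultimately show ?thesis
    using f_the_inv_into_f_bij_betw is_iso_mem[OF h x] by metis
qed

section \<open>Transfer of the Ramsey property\<close>

lemma qftp_respectingD:
  assumes "qftp_respecting_injection L A M B h" "set xs \<subseteq> univ A" "set ys \<subseteq> univ A"
    and "same_qf_type L A xs A ys"
  shows "same_qf_type M B (map h xs) B (map h ys)"
proof -
  have "length xs = length ys" using assms(4) unfolding same_qf_type_def by simp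
  then have "xs \<in> tuples A (length xs)" "ys \<in> tuples A (length xs)"
    using assms(2,3) unfolding tuples_def by simp_all
  then show ?thesis
    using assms(1,4) unfolding qftp_respecting_injection_def qf_equiv_same_qf_type by blast
qed

text \<open>A tuple realizes its own complete type, and that type contains each formula or its negation.\<close>

lemma semi_retraction_same_qf_type:
  assumes retr: "\<forall>n. \<forall>\<eta>\<in>complete_qf_types L A n. \<forall>xs\<in>tuples A n.
      realizes A xs \<eta> \<longrightarrow> realizes A (map \<rho> xs) \<eta>"
    and xs: "set xs \<subseteq> univ A"
  shows "same_qf_type L A xs A (map \<rho> xs)"
proof -
  let ?\<eta> = "{p. wf_formula L (length xs) p \<and> sat A xs p}"
  have t: "xs \<in> tuples A (length xs)" using xs unfolding tuples_def by simp
  then have "?\<eta> \<in> complete_qf_types L A (length xs)" unfolding complete_qf_types_def by blast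
  moreover have "realizes A xs ?\<eta>" unfolding realizes_def by simp
  ultimately have "realizes A (map \<rho> xs) ?\<eta>" using retr t by blast
  then have imp: "sat A (map \<rho> xs) p" if "wf_formula L (length xs) p" "sat A xs p" for p
    using that unfolding realizes_def by simp
  have "sat A xs p = sat A (map \<rho> xs) p" if "wf_formula L (length xs) p" for p
    using imp[OF that] imp[of "Neg p"] that by simp blast
  then show ?thesis unfolding same_qf_type_def by simp
qed

text \<open>
  The tuple \<open>ys\<close> may lie in any structure \<open>E\<close> that \<open>e\<close> embeds into \<open>B\<close>. The type is preserved by
  \<open>e\<close>, respected by \<open>f\<close>, and that of \<open>f(g(xs))\<close> is again that of \<open>xs\<close>.
\<close>

lemma pull_back_type:
  assumes g: "qftp_respecting_injection L A M B g" and f: "qftp_respecting_injection M B L A f"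
    and retr: "\<forall>n. \<forall>\<eta>\<in>complete_qf_types L A n. \<forall>xs\<in>tuples A n.
      realizes A xs \<eta> \<longrightarrow> realizes A (map (f \<circ> g) xs) \<eta>"
    and E: "is_struct M E" and e: "is_iso M E S e" and S: "S \<in> substructures M B"
    and xs: "set xs \<subseteq> univ A" and ys: "set ys \<subseteq> univ E"
    and eqv: "same_qf_type M B (map g xs) E ys"
  shows "same_qf_type L A xs A (map (f \<circ> e) ys)"
proof -
  have "same_qf_type M E ys B (map e ys)"
    using iso_same_qf_type[OF e E ys] same_qf_type_substructure(2)[OF S] by blast
  then have gB: "same_qf_type M B (map g xs) B (map e ys)"
    using eqv same_qf_type_trans by blast
  have "set (map g xs) \<subseteq> univ B"
    using g xs unfolding qftp_respecting_injection_def by auto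
  moreover have "set (map e ys) \<subseteq> univ B"
    using is_iso_mem[OF e] ys substructures_subset[OF S] by auto
  ultimately have "same_qf_type L A (map (f \<circ> g) xs) A (map (f \<circ> e) ys)"
    using qftp_respectingD[OF f _ _ gB] by simp
  then show ?thesis
    using semi_retraction_same_qf_type[OF retr xs] same_qf_type_trans by blast
qed

theorem corollary3p7:
  fixes L :: "('f, 'r) signature" and A :: "('f, 'r, 'a) struct"
    and M :: "('g, 's) signature" and B :: "('g, 's, 'b) struct"
  assumes "is_struct L A" and "is_struct M B"
    and "locally_finite L A" and "ordered_struct L A"
    and "locally_finite M B" and "ordered_struct M B"
    and "semi_retraction L A M B"
    and "has_RP M B"
  shows "has_RP L A"
  unfolding has_RP_def class_RP_def
proof (intro ballI allI impI)
  fix C D :: "('f, 'r, 'a) struct" and k :: nat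
  assume C: "C \<in> age L A" and D: "D \<in> age L A" and k: "k \<ge> 2"
  note A = assms(1) and B = assms(2)
  obtain g f where g: "qftp_respecting_injection L A M B g"
    and f: "qftp_respecting_injection M B L A f"
    and retr: "\<forall>n. \<forall>\<eta>\<in>complete_qf_types L A n. \<forall>xs\<in>tuples A n.
      realizes A xs \<eta> \<longrightarrow> realizes A (map (f \<circ> g) xs) \<eta>"
    using assms(7) unfolding semi_retraction_def by blast
  have g_mem: "g a \<in> univ B" if "a \<in> univ A" for a
    using g that unfolding qftp_respecting_injection_def by auto
  have f_mem: "f b \<in> univ A" if "b \<in> univ B" for b
    using f that unfolding qftp_respecting_injection_def by auto

  \<comment> \<open>Up to isomorphism, \<open>C\<close> and \<open>D\<close> are substructures of \<open>A\<close> enumerated by finite tuples.\<close>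
  have enum: "\<exists>xs. closed_in L A (set xs) \<and> isomorphic L X (A\<lparr>univ := set xs\<rparr>)"
    if X: "X \<in> age L A" for X
  proof -
    obtain S where S: "S \<in> fg_substructures L A" "isomorphic L X S"
      using X unfolding age_def by blast
    then obtain xs where xs: "set xs = univ S"
      using assms(3) finite_list unfolding locally_finite_def by blast
    have "S \<in> substructures L A" using fg_substructures_substructure[OF A S(1)] .
    then have "S = A\<lparr>univ := set xs\<rparr>" "closed_in L A (set xs)"
      unfolding substructures_iff xs by auto
    then show ?thesis using S(2) by blast
  qed
  obtain cs where cs: "closed_in L A (set cs)" and C_iso: "isomorphic L C (A\<lparr>univ := set cs\<rparr>)"
    using enum[OF C] by blast
  obtain ds where ds: "closed_in L A (set ds)" and D_iso: "isomorphic L D (A\<lparr>univ := set ds\<rparr>)"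
    using enum[OF D] by blast
  let ?C = "A\<lparr>univ := set cs\<rparr>" and ?D = "A\<lparr>univ := set ds\<rparr>"
  have copies_C: "copies L X C = copies L X ?C" for X
    using copies_cong C C_iso unfolding age_def by blast
  have copies_D: "copies L X D = copies L X ?D" for X
    using copies_cong D D_iso unfolding age_def by blast
  have cs_A: "set cs \<subseteq> univ A" and ds_A: "set ds \<subseteq> univ A"
    using cs ds unfolding closed_in_def by auto
  have C_struct: "is_struct L ?C" and D_struct: "is_struct L ?D"
    using is_struct_restrict cs ds by blast+
  have C_sub: "?C \<in> substructures L A" and D_sub: "?D \<in> substructures L A"
    using cs ds unfolding substructures_def by blast+

  define CB where "CB = generated M B (set (map g cs))"
  define DB where "DB = generated M B (set (map g ds))"
  have gcs: "set (map g cs) \<subseteq> univ B" and gds: "set (map g ds) \<subseteq> univ B"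
    using g_mem cs_A ds_A by auto
  have CB_sub: "CB \<in> substructures M B" and DB_sub: "DB \<in> substructures M B"
    unfolding CB_def DB_def using generated_substructure[OF B] gcs gds by blast+
  have CB_struct: "is_struct M CB" and DB_struct: "is_struct M DB"
    using substructures_is_struct CB_sub DB_sub by blast+
  have gcs_CB: "set (map g cs) \<subseteq> univ CB" and gds_DB: "set (map g ds) \<subseteq> univ DB"
    unfolding CB_def DB_def by (rule generated_superset)+
  have fg: "CB \<in> fg_substructures M B" "DB \<in> fg_substructures M B"
    unfolding CB_def DB_def fg_substructures_def using gcs gds by blast+
  have CB_fin: "finite (univ CB)" using fg assms(5) unfolding locally_finite_def by blast

  have "CB \<in> age M B" "DB \<in> age M B" using fg fg_substructure_in_age[OF B] by blast+
  then obtain EB where EB: "EB \<in> age M B" and EB_ramsey: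
    "\<forall>c \<in> copies M EB CB \<rightarrow> {..<k}. \<exists>D'\<in>copies M EB DB.
       \<forall>S\<in>copies M D' CB. \<forall>T\<in>copies M D' CB. c S = c T"
    using assms(8) k unfolding has_RP_def class_RP_def by blast
  have EB_struct: "is_struct M EB" using EB unfolding age_def by simp
  obtain S\<^sub>E e where S\<^sub>E: "S\<^sub>E \<in> fg_substructures M B" and e: "is_iso M EB S\<^sub>E e"
    using EB unfolding age_def isomorphic_def by blast
  have S\<^sub>E_sub: "S\<^sub>E \<in> substructures M B" using fg_substructures_substructure[OF B S\<^sub>E] .
  have "finite (univ S\<^sub>E)" using S\<^sub>E assms(5) unfolding locally_finite_def by blast
  then have EB_fin: "finite (univ EB)"
    using e bij_betw_finite unfolding is_iso_def by blast
  let ?\<phi> = "f \<circ> e"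
  have \<phi>_A: "?\<phi> ` univ EB \<subseteq> univ A"
    using f_mem is_iso_mem[OF e] substructures_subset[OF S\<^sub>E_sub] by auto

  define E where "E = generated L A (?\<phi> ` univ EB)"
  have E_sub: "E \<in> substructures L A" unfolding E_def using generated_substructure[OF A \<phi>_A] .
  have E_struct: "is_struct L E" using substructures_is_struct[OF E_sub] .
  have \<phi>_E: "?\<phi> ` univ EB \<subseteq> univ E" unfolding E_def by (rule generated_superset)
  have E_upd: "E\<lparr>univ := U\<rparr> = A\<lparr>univ := U\<rparr>" for U unfolding E_def generated_def by simp
  have "E \<in> fg_substructures L A"
    unfolding fg_substructures_def E_def using EB_fin \<phi>_A by blast
  then have E_age: "E \<in> age L A" using fg_substructure_in_age[OF A] by blast

  \<comment> \<open>This serves \<open>cs\<close>, to induce the colouring on \<open>EB\<close>, and \<open>ds\<close>, to recover the homogeneous copy.\<close>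
  have pull: "A\<lparr>univ := (?\<phi> \<circ> \<sigma> \<circ> g) ` set xs\<rparr> \<in> substructures L E \<and>
      is_iso L (A\<lparr>univ := set xs\<rparr>) (A\<lparr>univ := (?\<phi> \<circ> \<sigma> \<circ> g) ` set xs\<rparr>) (?\<phi> \<circ> \<sigma> \<circ> g)"
    if xs: "closed_in L A (set xs)" and \<sigma>: "is_iso M (generated M B (set (map g xs))) T \<sigma>"
      and T: "T \<in> substructures M EB" for xs \<sigma> T
  proof -
    let ?G = "generated M B (set (map g xs))"
    have xs_A: "set xs \<subseteq> univ A" using xs unfolding closed_in_def by simp
    have "set (map g xs) \<subseteq> univ B" using g_mem xs_A by auto
    then have G: "?G \<in> substructures M B" using generated_substructure[OF B] by blast
    have gxs: "set (map g xs) \<subseteq> univ ?G" by (rule generated_superset)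
    have mem: "set (map \<sigma> (map g xs)) \<subseteq> univ EB"
      using gxs is_iso_mem[OF \<sigma>] substructures_subset[OF T] by auto
    have "same_qf_type M B (map g xs) EB (map \<sigma> (map g xs))"
      using iso_same_qf_type[OF \<sigma> substructures_is_struct[OF G] gxs]
        same_qf_type_substructure(1)[OF G] same_qf_type_substructure(2)[OF T] by blast
    then have "same_qf_type L A xs A (map ?\<phi> (map \<sigma> (map g xs)))"
      using pull_back_type[OF g f retr EB_struct e S\<^sub>E_sub xs_A mem] by blast
    then have "same_qf_type L A xs A (map (?\<phi> \<circ> \<sigma> \<circ> g) xs)" by (simp add: comp_assoc)
    then have type: "same_qf_type L A xs E (map (?\<phi> \<circ> \<sigma> \<circ> g) xs)"
      using same_qf_type_substructure(2)[OF E_sub] by blast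
    have "set (map (?\<phi> \<circ> \<sigma> \<circ> g) xs) \<subseteq> univ E" using mem \<phi>_E by auto
    from same_qf_type_closed[OF A E_struct xs this type] show ?thesis
      by (simp add: E_upd)
  qed

  show "\<exists>E\<in>age L A. \<forall>c\<in>copies L E C \<rightarrow> {..<k}. \<exists>D'\<in>copies L E D.
      \<forall>S\<in>copies L D' C. \<forall>T\<in>copies L D' C. c S = c T"
  proof (intro bexI[OF _ E_age] ballI)
    fix c assume c: "c \<in> copies L E C \<rightarrow> {..<k}"
    define iso where "iso T = (SOME \<sigma>. is_iso M CB T \<sigma>)" for T :: "('g, 's, 'b) struct"
    define c' where "c' T = c (A\<lparr>univ := (?\<phi> \<circ> iso T \<circ> g) ` set cs\<rparr>)" for T
    have iso: "is_iso M CB T (iso T)" if "T \<in> copies M X CB" for T X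
    proof -
      have "isomorphic M T CB" "T \<in> substructures M X" using that unfolding copies_def by auto
      then have "\<exists>\<sigma>. is_iso M CB T \<sigma>"
        using isomorphic_sym[OF substructures_is_struct] unfolding isomorphic_def by blast
      then show ?thesis unfolding iso_def by (rule someI_ex)
    qed
    have "c' \<in> copies M EB CB \<rightarrow> {..<k}"
    proof
      fix T assume T: "T \<in> copies M EB CB"
      let ?S = "A\<lparr>univ := (?\<phi> \<circ> iso T \<circ> g) ` set cs\<rparr>"
      have "T \<in> substructures M EB" using T unfolding copies_def by simp
      then have S: "?S \<in> substructures L E" "is_iso L ?C ?S (?\<phi> \<circ> iso T \<circ> g)"
        using pull[OF cs iso[OF T, unfolded CB_def]] by blast+
      then have "?S \<in> copies L E ?C"
        using isomorphic_sym[OF C_struct] unfolding copies_def isomorphic_def by blast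
      then show "c' T \<in> {..<k}" using c copies_C unfolding c'_def by blast
    qed
    then obtain DB' where DB': "DB' \<in> copies M EB DB"
      and hom: "\<forall>S\<in>copies M DB' CB. \<forall>T\<in>copies M DB' CB. c' S = c' T"
      using EB_ramsey by blast
    have DB'_sub: "DB' \<in> substructures M EB" using DB' unfolding copies_def by simp
    have DB'_struct: "is_struct M DB'" using substructures_is_struct[OF DB'_sub] .
    obtain \<tau> where \<tau>: "is_iso M DB DB' \<tau>"
      using DB' isomorphic_sym[OF DB'_struct] unfolding copies_def isomorphic_def by blast
    let ?\<theta> = "?\<phi> \<circ> \<tau> \<circ> g"
    define D' where "D' = A\<lparr>univ := ?\<theta> ` set ds\<rparr>"
    have D'_sub: "D' \<in> substructures L E" and \<theta>: "is_iso L ?D D' ?\<theta>"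
      unfolding D'_def using pull[OF ds \<tau>[unfolded DB_def] DB'_sub] by blast+
    have D'_subA: "D' \<in> substructures L A" using substructures_trans[OF D'_sub E_sub] .
    have "D' \<in> copies L E D"
      unfolding copies_D using D'_sub isomorphic_sym[OF D_struct] \<theta>
      unfolding copies_def isomorphic_def by blast

    moreover have "\<exists>T\<in>copies M DB' CB. c S = c' T" if S: "S \<in> copies L D' C" for S
    proof -
      have S_sub: "S \<in> substructures L D'" and S_iso: "isomorphic L S ?C"
        using S unfolding copies_C by (auto simp: copies_def)
      have S_subA: "S \<in> substructures L A" using substructures_trans[OF S_sub D'_subA] .
      obtain \<rho> where \<rho>: "is_iso L ?C S \<rho>"
        using isomorphic_sym[OF substructures_is_struct[OF S_sub] S_iso]
        unfolding isomorphic_def by blast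
      have \<rho>_univ: "\<rho> ` set cs = univ S" using \<rho> unfolding is_iso_def bij_betw_def by simp
      \<comment> \<open>Lift the enumeration \<open>\<rho>(cs)\<close> of \<open>S\<close> along \<open>\<theta>\<close> to a tuple \<open>zs\<close> of \<open>D\<close>.\<close>
      let ?k = "the_inv_into (set ds) ?\<theta>"
      define zs where "zs = map (?k \<circ> \<rho>) cs"
      have S_D': "univ S \<subseteq> univ D'" using substructures_subset[OF S_sub] .
      have \<theta>_bij: "bij_betw ?\<theta> (set ds) (univ D')" using \<theta> unfolding is_iso_def by simp
      have k_iso: "is_iso L D' ?D ?k" using is_iso_inv[OF \<theta> D_struct] by simp
      have zs_D: "set zs \<subseteq> set ds"
        using is_iso_mem[OF k_iso] S_D' \<rho>_univ unfolding zs_def by auto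
      have \<theta>_zs: "map ?\<theta> zs = map \<rho> cs"
        using f_the_inv_into_f_bij_betw[OF \<theta>_bij] S_D' \<rho>_univ unfolding zs_def by fastforce
      have "same_qf_type L A cs A (map \<rho> cs)"
        using iso_same_qf_type[OF \<rho> C_struct, of cs]
        unfolding same_qf_type_substructure(2)[OF S_subA] same_qf_type_substructure(1)[OF C_sub]
        by simp
      moreover have "same_qf_type L A zs A (map ?\<theta> zs)"
        using iso_same_qf_type[OF \<theta> D_struct, of zs] zs_D
        unfolding same_qf_type_substructure(2)[OF D'_subA] same_qf_type_substructure(1)[OF D_sub]
        by simp
      ultimately have "same_qf_type L A cs A zs"
        using same_qf_type_sym same_qf_type_trans unfolding \<theta>_zs by blast
      then have gtype: "same_qf_type M B (map g cs) B (map g zs)"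
        using qftp_respectingD[OF g cs_A] zs_D ds_A by blast
      have gzs: "set (map g zs) \<subseteq> univ DB" using gds_DB zs_D by auto
      have "same_qf_type M B (map g zs) DB' (map \<tau> (map g zs))"
        using iso_same_qf_type[OF \<tau> DB_struct gzs] same_qf_type_substructure(1)[OF DB_sub] by blast
      then have type: "same_qf_type M B (map g cs) DB' (map \<tau> (map g zs))"
        using gtype same_qf_type_trans by blast
      have \<tau>_mem: "set (map \<tau> (map g zs)) \<subseteq> univ DB'" using is_iso_mem[OF \<tau>] gzs by auto
      define T where "T = generated M DB' (set (map \<tau> (map g zs)))"
      obtain \<sigma> where \<sigma>: "is_iso M CB T \<sigma>" and \<sigma>_eq: "map \<sigma> (map g cs) = map \<tau> (map g zs)"
        using same_qf_type_imp_iso[OF B gcs DB'_struct \<tau>_mem type] unfolding CB_def T_def by blast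
      have "T \<in> substructures M DB'" unfolding T_def using generated_substructure[OF DB'_struct \<tau>_mem] .
      then have T: "T \<in> copies M DB' CB"
        using isomorphic_sym[OF CB_struct] \<sigma> unfolding copies_def isomorphic_def by blast
      have "map (iso T) (map g cs) = map \<sigma> (map g cs)"
        using iso_unique[OF assms(6) CB_sub CB_fin iso[OF T] \<sigma>] gcs_CB by auto
      then have "map ?\<phi> (map (iso T) (map g cs)) = map ?\<phi> (map \<tau> (map g zs))"
        using \<sigma>_eq by metis
      then have "map (?\<phi> \<circ> iso T \<circ> g) cs = map \<rho> cs"
        using \<theta>_zs by (simp only: map_map comp_assoc)
      then have "(?\<phi> \<circ> iso T \<circ> g) ` set cs = univ S"
        unfolding \<rho>_univ[symmetric] set_map[symmetric] by (rule arg_cong)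
      then have "c' T = c (A\<lparr>univ := univ S\<rparr>)" unfolding c'_def by (rule arg_cong)
      also have "A\<lparr>univ := univ S\<rparr> = S" using S_subA unfolding substructures_iff by simp
      finally show ?thesis using T by metis
    qed
    then have "\<forall>S\<in>copies L D' C. \<forall>T\<in>copies L D' C. c S = c T" using hom by metis
    ultimately show "\<exists>D'\<in>copies L E D. \<forall>S\<in>copies L D' C. \<forall>T\<in>copies L D' C. c S = c T" by blast
  qed
qed

end
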